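(* Let $R$ be a ring. Then the unit graph $G(R)$ is a complete $r$-partite graph for some positive integer $r$ if and only if at least one of the following holds: (i) $R$ is a local ring with unique maximal left ideal $\mathfrak{m}$ and $|R/\mathfrak{m}| = 2^n$ for some positive integer $n$, in which case $r = |R/\mathfrak{m}| = 2^n$; or (ii) $R$ is a finite field.
   Context: Rings are associative, not necessarily commutative, with identity $1 \neq 0$. The unit graph $G(R)$ is the simple graph (no loops, no multiple edges) whose vertices are the elements of $R$, where two distinct vertices $a, b$ are adjacent if and only if $a+b$ is a unit of $R$. A ring is local if it has exactly one maximal left ideal. For a positive integer $r$, a graph is complete $r$-partite if its vertex set admits a partition into $r$ (nonempty) classes such that vertices in the same class are never adjacent and any two vertices in different classes are adjacent. *)

theory Defs
  imports "HOL-Algebra.Algebra" "HOL-Library.Disjoint_Sets"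
begin

text \<open>Rings are those of \<^locale>\<open>ring\<close>: associative and unital, not necessarily commutative. As
  \<^locale>\<open>ideal\<close> and \<^locale>\<open>maximalideal\<close> of the library are two-sided, their one-sided versions
  are introduced here.\<close>

locale left_ideal = additive_subgroup I R + ring R for I and R (structure) +
  assumes left_closed: "\<lbrakk>a \<in> I; x \<in> carrier R\<rbrakk> \<Longrightarrow> x \<otimes> a \<in> I"

locale maximal_left_ideal = left_ideal +
  assumes I_notcarrier: "carrier R \<noteq> I"
    and I_maximal: "\<lbrakk>left_ideal J R; I \<subseteq> J; J \<subseteq> carrier R\<rbrakk> \<Longrightarrow> J = I \<or> J = carrier R"

definition local_ring :: "('a, 'b) ring_scheme \<Rightarrow> bool" where
  "local_ring R \<longleftrightarrow> ring R \<and> (\<exists>!I. maximal_left_ideal I R)"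

text \<open>A simple graph is a pair of a vertex set and a set of edges, each edge being a set of two
  distinct vertices.\<close>

type_synonym 'a simple_graph = "'a set \<times> 'a set set"

definition unit_graph :: "('a, 'b) ring_scheme \<Rightarrow> 'a simple_graph" where
  "unit_graph R =
     (carrier R,
      {{a, b} | a b. a \<in> carrier R \<and> b \<in> carrier R \<and> a \<noteq> b \<and> a \<oplus>\<^bsub>R\<^esub> b \<in> Units R})"

text \<open>The classes are nonempty because \<^const>\<open>partition_on\<close> demands it. For \<open>a = b\<close> the
  set \<open>{a, b}\<close> is a singleton, hence not an edge.\<close>

definition complete_partite :: "nat \<Rightarrow> 'a simple_graph \<Rightarrow> bool" where
  "complete_partite r G \<longleftrightarrow>
     (\<exists>P. partition_on (fst G) P \<and> finite P \<and> card P = r \<and>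
        (\<forall>A\<in>P. \<forall>a\<in>A. \<forall>b\<in>A. {a, b} \<notin> snd G) \<and>
        (\<forall>A\<in>P. \<forall>B\<in>P. A \<noteq> B \<longrightarrow> (\<forall>a\<in>A. \<forall>b\<in>B. {a, b} \<in> snd G)))"

end

theory Submission
  imports Defs
begin

text \<open>In a complete multipartite graph non-adjacency is an equivalence relation whose classes are the
  parts. In a unit graph the class of \<open>0\<close> consists of the nonunits, so these are closed under
  addition and form the unique maximal left ideal \<open>N\<close>. A nonzero \<open>x \<in> N\<close> makes both \<open>x - 1\<close> and
  \<open>-1\<close> non-adjacent to \<open>1\<close>, hence to each other; this forces \<open>2 \<in> N\<close>, the classes are then
  the cosets of \<open>N\<close>, and \<open>R/N\<close> is a finite elementary abelian 2-group. If \<open>N = 0\<close>, all classes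
  are of the form \<open>{a, -a}\<close>, so \<open>R\<close> is a finite division ring and thus a field by Wedderburn's
  little theorem, proved here by Witt's argument with the class equation and cyclotomic values.
  Conversely, \<open>2\<close> is a nonunit in a local ring whose residue field has \<open>2 ^ n\<close> elements.\<close>

section \<open>Cyclotomic values\<close>

lemma minus_1_dvd_power_minus_1:
  fixes x :: nat
  shows "x - 1 dvd x ^ k - 1"
proof (cases x)
  case (Suc y)
  have "y dvd Suc y ^ k - 1"
  proof (induction k)
    case (Suc k)
    have "Suc y ^ Suc k - 1 = y * Suc y ^ k + (Suc y ^ k - 1)"
      by (simp add: algebra_simps)
    then show ?case
      using Suc by (metis dvd_add dvd_triv_left)
  qed auto
  then show ?thesis using Suc by simp
qed (cases k; simp)

lemma power_minus_1_dvd: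
  fixes x :: nat
  assumes "m dvd n"
  shows "x ^ m - 1 dvd x ^ n - 1"
  using assms minus_1_dvd_power_minus_1[of "x ^ m"] by (auto simp: power_mult elim!: dvdE)

text \<open>Euclid's algorithm runs on the exponents: \<open>x ^ m - 1\<close> is congruent to
  \<open>x ^ (m mod n) - 1\<close> modulo \<open>x ^ n - 1\<close>.\<close>

lemma gcd_power_minus_1:
  fixes x :: nat
  assumes "x \<ge> 1"
  shows "gcd (x ^ m - 1) (x ^ n - 1) = x ^ gcd m n - 1"
proof (induction m n rule: gcd_nat_induct)
  case (step m n)
  define r where "r = m mod n"
  obtain c where c: "(x ^ n) ^ (m div n) - 1 = (x ^ n - 1) * c"
    using minus_1_dvd_power_minus_1 by (metis dvdE)
  have "x ^ m = x ^ r * (x ^ n) ^ (m div n)"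
    unfolding r_def by (metis mod_mult_div_eq power_add power_mult)
  also have "(x ^ n) ^ (m div n) = (x ^ n - 1) * c + 1"
    unfolding c[symmetric] using assms by simp
  finally have "x ^ m - 1 = (x ^ r * c) * (x ^ n - 1) + (x ^ r - 1)"
    using assms by (simp add: algebra_simps)
  then have "gcd (x ^ n - 1) (x ^ m - 1) = gcd (x ^ n - 1) (x ^ r - 1)"
    by (simp only: gcd_add_mult)
  also have "\<dots> = x ^ gcd n r - 1"
    using step unfolding r_def by blast
  also have "gcd n r = gcd m n"
    unfolding r_def by (rule gcd_red_nat[symmetric])
  finally show ?case by (simp only: gcd.commute)
qed auto

text \<open>Divisibility is a distributive lattice; this lets the gcd in
  \<open>cyclotomic_insert\<close> be taken term by term.\<close>

lemma gcd_Lcm_distrib: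
  fixes c :: nat
  assumes "finite A"
  shows "gcd c (Lcm A) = Lcm (gcd c ` A)"
  using assms by (induction A rule: finite_induct) (simp_all add: gcd_lcm_distrib)

text \<open>With z = (y + 1)^p - 1, this inequality and the next read y^(p-1) (y + 2) < z and z + 2
  \<le> (y + 2)^(p-1) y. Their m-th powers carry the bounds y^m and (y + 2)^m across the insertion
  of an odd prime p. Both fail for p = 2, where z = y (y + 2).\<close>

lemma power_Suc_gt:
  fixes y p :: nat
  shows "p \<ge> 3 \<Longrightarrow> y \<ge> 1 \<Longrightarrow> y ^ (p - 1) * (y + 2) + 1 < (y + 1) ^ p"
proof (induction p rule: nat_induct_at_least)
  case base
  then show ?case by (simp add: power3_eq_cube numeral_eq_Suc algebra_simps)
next
  case (Suc p)
  obtain k where k: "p = Suc k" using Suc by (cases p) auto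
  have "y ^ (Suc p - 1) * (y+2) + 1 = y * (y ^ (p-1) * (y+2)) + 1" unfolding k by (simp add: algebra_simps)
  also have "\<dots> \<le> y * (y+1)^p + 1" using Suc by (auto intro!: mult_left_mono simp del: add_Suc_right)
  also have "\<dots> < (y+1)^Suc p" using Suc by (auto simp: algebra_simps)
  finally show ?case .
qed

lemma power_Suc_le:
  fixes y p :: nat
  shows "p \<ge> 3 \<Longrightarrow> y \<ge> 1 \<Longrightarrow> (y + 1) ^ p + 1 \<le> (y + 2) ^ (p - 1) * y"
proof (induction p rule: nat_induct_at_least)
  case base
  then have "1 * 1 \<le> y * y" by (intro mult_mono) auto
  with base have "2 \<le> y * y + y" by linarith
  then show ?case by (simp add: numeral_eq_Suc algebra_simps)
next
  case (Suc p)
  obtain k where k: "p = Suc k" using Suc by (cases p) auto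
  have "(y+1)^Suc p + 1 \<le> (y+2) * ((y+1)^p + 1)" by (simp add: algebra_simps)
  also have "\<dots> \<le> (y+2) * ((y + 2) ^ (p-1) * y)" using Suc by (intro mult_left_mono) auto
  also have "\<dots> = (y+2) ^ (Suc p - 1) * y" unfolding k by (simp add: algebra_simps)
  finally show ?case .
qed

definition proper_lcm :: "nat set \<Rightarrow> nat \<Rightarrow> nat" where
  "proper_lcm S x = Lcm ((\<lambda>s. x ^ (\<Prod>S div s) - 1) ` S)"

text \<open>For a set \<open>S\<close> of primes this is the value at \<open>x\<close> of the cyclotomic polynomial of index
  \<open>\<Prod>S\<close>; the lemma \<open>cyclotomic_insert\<close> below is the recursion
  \<open>\<Phi>\<^sub>N\<^sub>p(x) = \<Phi>\<^sub>N(x\<^sup>p) / \<Phi>\<^sub>N(x)\<close>. Defining it as a quotient by a least common multiple keeps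
  everything in the natural numbers and makes the divisibility needed for the class equation
  immediate.\<close>

definition cyclotomic :: "nat set \<Rightarrow> nat \<Rightarrow> nat" where
  "cyclotomic S x = (x ^ \<Prod>S - 1) div proper_lcm S x"

section \<open>Cyclotomic values at sets of primes: recursion and bounds\<close>

locale prime_set =
  fixes S :: "nat set"
  assumes fin: "finite S" and prime: "\<And>s. s \<in> S \<Longrightarrow> Factorial_Ring.prime s"
begin

lemma dvd: "s \<in> S \<Longrightarrow> s dvd \<Prod>S"
  using fin dvd_prodI[of S s "\<lambda>x. x"] by simp

lemma pos: "\<Prod>S > 0"
  using prime by (meson prod_pos prime_gt_0_nat)

text \<open>The division in \<open>cyclotomic\<close> is exact, because each number under the lcm
  divides \<open>x ^ \<Prod>S - 1\<close>.\<close>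

lemma cyclotomic_mult: "cyclotomic S x * proper_lcm S x = x ^ \<Prod>S - 1"
proof -
  have "proper_lcm S x dvd x ^ \<Prod>S - 1"
    unfolding proper_lcm_def
  proof (rule Lcm_least)
    fix a assume "a \<in> (\<lambda>s. x ^ (\<Prod>S div s) - 1) ` S"
    then obtain s where "s \<in> S" "a = x ^ (\<Prod>S div s) - 1" by auto
    then show "a dvd x ^ \<Prod>S - 1"
      using dvd[of s] power_minus_1_dvd[of "\<Prod>S div s" "\<Prod>S" x] by (metis div_dvd_div dvd_div_mult_self dvd_triv_left)
  qed
  then show ?thesis by (simp add: cyclotomic_def)
qed

lemma proper_lcm_pos:
  assumes "x \<ge> 2"
  shows "proper_lcm S x > 0"
proof -
  have "x ^ \<Prod>S > 1" using assms pos by (intro one_less_power) auto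
  then have "cyclotomic S x * proper_lcm S x \<noteq> 0" by (simp only: cyclotomic_mult)
  then show ?thesis by simp
qed

text \<open>Write N for \<open>\<Prod>S\<close> and L for \<open>proper_lcm S\<close>. The lcm for
  \<open>insert p S\<close> at x is lcm(x^N - 1, L(x^p)), and the gcd of the same two numbers is
  L(x). As lcm times gcd is the product, the new lcm is \<open>cyclotomic S x\<close> times L(x^p);
  comparing two exact factorizations of x^(pN) - 1 gives the claim.\<close>

lemma cyclotomic_insert:
  assumes "Factorial_Ring.prime p" "p \<notin> S" "x \<ge> 2"
  shows "cyclotomic (insert p S) x * cyclotomic S x = cyclotomic S (x ^ p)"
proof -
  interpret T: prime_set "insert p S"
    by unfold_locales (use assms fin prime in auto)
  define N where "N = \<Prod>S"
  have p0: "p > 0" using assms prime_gt_0_nat by blast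
  have TN: "\<Prod>(insert p S) = p * N"
    using assms fin by (simp add: N_def)
  have div: "p * N div s = p * (N div s)" if "s \<in> S" for s
    using dvd[OF that] by (simp add: N_def div_mult_swap)
  have eq1: "proper_lcm (insert p S) x = lcm (x ^ N - 1) (proper_lcm S (x ^ p))"
    unfolding proper_lcm_def TN using div p0
    by (simp add: Lcm_insert N_def[symmetric] power_mult cong: image_cong_simp)
  \<comment> \<open>These are the exponents that arise when the gcd formula is applied to x^N - 1
    and each number under L(x^p).\<close>
  have g: "gcd N (p * (N div s)) = N div s" if s: "s \<in> S" for s
  proof -
    have "coprime s p"
      using assms prime[OF s] s primes_coprime by metis
    then have "gcd ((N div s) * s) ((N div s) * p) = N div s"
      using gcd_mult_distrib_nat[of "N div s" s p] by simp
    moreover have "(N div s) * s = N" using dvd[OF s] by (simp add: N_def)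
    ultimately show ?thesis by (simp only: mult.commute[of p])
  qed
  have "gcd (x ^ N - 1) (proper_lcm S (x ^ p)) = proper_lcm S x"
    unfolding proper_lcm_def gcd_Lcm_distrib[OF finite_imageI[OF fin]] image_image power_mult[symmetric]
    using assms g by (intro arg_cong[of _ _ Lcm] image_cong) (simp_all add: gcd_power_minus_1[simplified] N_def)
  then have "proper_lcm (insert p S) x * proper_lcm S x = (x ^ N - 1) * proper_lcm S (x ^ p)"
    using lcm_mult_gcd[of "x ^ N - 1" "proper_lcm S (x ^ p)"]
    by (simp only: eq1 normalize_nat_def id_apply)
  also have "x ^ N - 1 = cyclotomic S x * proper_lcm S x"
    by (simp only: cyclotomic_mult N_def)
  finally have "proper_lcm (insert p S) x * proper_lcm S x =
      cyclotomic S x * proper_lcm S (x ^ p) * proper_lcm S x"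
    by (simp only: ac_simps)
  moreover have "proper_lcm S x \<noteq> 0" using proper_lcm_pos[OF assms(3)] by simp
  ultimately have L: "proper_lcm (insert p S) x = cyclotomic S x * proper_lcm S (x ^ p)"
    by (rule mult_right_cancel[THEN iffD1, rotated])
  have "cyclotomic (insert p S) x * proper_lcm (insert p S) x = cyclotomic S (x ^ p) * proper_lcm S (x ^ p)"
    unfolding cyclotomic_mult T.cyclotomic_mult TN by (simp add: N_def power_mult)
  then have eq: "cyclotomic (insert p S) x * cyclotomic S x * proper_lcm S (x ^ p) =
      cyclotomic S (x ^ p) * proper_lcm S (x ^ p)"
    by (simp only: L mult.assoc)
  have Lp: "proper_lcm S (x ^ p) \<noteq> 0"
    using proper_lcm_pos[of "x ^ p"] self_le_power[of x p] p0 assms(3) by linarith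
  from eq show ?thesis unfolding mult_right_cancel[OF Lp] .
qed

text \<open>By the recursion the value is the quotient of \<open>cyclotomic S (z + 1)\<close> by
  \<open>cyclotomic S (y + 1)\<close>, where z + 1 = (y + 1)^p. Each new bound combines opposite old
  bounds for numerator and denominator, so both must travel together through the induction.\<close>

lemma cyclotomic_insert_odd:
  assumes p: "Factorial_Ring.prime p" "p \<notin> S" "odd p" and y: "y \<ge> 1"
    and IH: "\<And>y. y \<ge> 1 \<Longrightarrow> y ^ m \<le> cyclotomic S (y + 1) \<and> cyclotomic S (y + 1) \<le> (y + 2) ^ m"
    and m: "m > 0"
  shows "y ^ ((p - 1) * m) < cyclotomic (insert p S) (y + 1)"
    and "cyclotomic (insert p S) (y + 1) \<le> (y + 2) ^ ((p - 1) * m)"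
proof -
  have "p \<noteq> 2" using p(3) by auto
  then have p3: "p \<ge> 3" using prime_ge_2_nat[OF p(1)] by linarith
  define z where "z = (y + 1) ^ p - 1"
  have z1: "z + 1 = (y + 1) ^ p" by (simp add: z_def)
  note lo = power_Suc_gt[OF p3 y] and up = power_Suc_le[OF p3 y]
  have z: "z \<ge> 1" using lo by (simp add: z_def)
  have rec: "cyclotomic (insert p S) (y + 1) * cyclotomic S (y + 1) = cyclotomic S (z + 1)"
    using cyclotomic_insert[OF p(1,2), of "y + 1"] y z1 by simp
  have "y ^ ((p - 1) * m) * (y + 2) ^ m = (y ^ (p - 1) * (y + 2)) ^ m"
    by (simp only: power_mult power_mult_distrib)
  also have "\<dots> < z ^ m"
    using lo z1 m by (intro power_strict_mono) auto
  also have "\<dots> \<le> cyclotomic S (z + 1)" using IH[OF z] by blast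
  also have "\<dots> \<le> cyclotomic (insert p S) (y + 1) * (y + 2) ^ m"
    unfolding rec[symmetric] using IH[OF y] by (intro mult_left_mono) auto
  finally show "y ^ ((p - 1) * m) < cyclotomic (insert p S) (y + 1)"
    by (rule mult_right_less_imp_less) simp
  have "cyclotomic (insert p S) (y + 1) * y ^ m \<le> cyclotomic S (z + 1)"
    unfolding rec[symmetric] using IH[OF y] by (intro mult_left_mono) auto
  also have "\<dots> \<le> (z + 2) ^ m" using IH[OF z] by blast
  also have "\<dots> \<le> ((y + 2) ^ (p - 1) * y) ^ m"
    using up z1 by (intro power_mono) auto
  also have "\<dots> = (y + 2) ^ ((p - 1) * m) * y ^ m"
    by (simp only: power_mult power_mult_distrib)
  finally show "cyclotomic (insert p S) (y + 1) \<le> (y + 2) ^ ((p - 1) * m)"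
    by (rule mult_right_le_imp_le) (use y in simp)
qed

end

text \<open>The witness m is the degree of the cyclotomic polynomial: the product of all p - 1,
  starting from 1 for the empty set. There the value is y itself, so strictness sets in only with
  the first prime.\<close>

lemma cyclotomic_bounds_odd:
  assumes "finite S" "\<And>s. s \<in> S \<Longrightarrow> Factorial_Ring.prime s \<and> odd s"
  shows "\<exists>m>0. \<forall>y\<ge>1. y ^ m \<le> cyclotomic S (y + 1) \<and> cyclotomic S (y + 1) \<le> (y + 2) ^ m \<and>
     (S \<noteq> {} \<longrightarrow> y ^ m < cyclotomic S (y + 1))"
  using assms
proof (induction S rule: finite_induct)
  case empty
  show ?case by (rule exI[of _ 1]) (simp add: cyclotomic_def proper_lcm_def)
next
  case (insert p S)
  have prm: "Factorial_Ring.prime s" "odd s" if "s \<in> insert p S" for s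
    using insert.prems that by blast+
  interpret prime_set S by unfold_locales (rule insert.hyps(1), rule prm, rule insertI2)
  obtain m where m: "m > 0" and IH: "\<And>y. y \<ge> 1 \<Longrightarrow> y ^ m \<le> cyclotomic S (y + 1) \<and> cyclotomic S (y + 1) \<le> (y + 2) ^ m"
    using insert.IH insert.prems by blast
  have p: "Factorial_Ring.prime p" "odd p" using prm by blast+
  note step = cyclotomic_insert_odd[OF p(1) insert.hyps(2) p(2) _ IH m]
  have "(p - 1) * m > 0" using m prime_gt_1_nat[OF p(1)] by simp
  then show ?case
    using step(1) step(2) less_imp_le[OF step(1)] by (intro exI[of _ "(p - 1) * m"]) blast
qed

text \<open>The upper bound \<open>(y + 2) ^ m\<close> is not inherited when the prime 2 is inserted
  (\<open>\<Phi>\<^sub>2\<^sub>N(x) = \<Phi>\<^sub>N(-x)\<close> for odd \<open>N\<close>), so 2 is treated last, where only the lower bound is needed.\<close>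

lemma cyclotomic_gt:
  assumes "finite S" "\<And>s. s \<in> S \<Longrightarrow> Factorial_Ring.prime s" "S \<noteq> {}" and y: "y \<ge> 1"
  shows "y < cyclotomic S (y + 1)"
proof -
  define T where "T = S - {2}"
  have "Factorial_Ring.prime s \<and> odd s" if "s \<in> T" for s
  proof -
    have "Factorial_Ring.prime s" "s \<noteq> 2" using that assms(2) by (auto simp: T_def)
    then show ?thesis using prime_ge_2_nat[of s] prime_odd_nat[of s] by linarith
  qed
  moreover have "finite T" using assms(1) by (simp add: T_def)
  ultimately obtain m where m: "m > 0"
    and bnd: "\<And>y. y \<ge> 1 \<Longrightarrow> y ^ m \<le> cyclotomic T (y + 1) \<and> cyclotomic T (y + 1) \<le> (y + 2) ^ m \<and>
     (T \<noteq> {} \<longrightarrow> y ^ m < cyclotomic T (y + 1))"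
    using cyclotomic_bounds_odd[of T] by blast
  have "y ^ m \<ge> y" using m y by (simp add: self_le_power)
  moreover have "y ^ m < cyclotomic S (y + 1)"
  proof (cases "2 \<in> S")
    case False
    then have "T = S" by (auto simp: T_def)
    then show ?thesis using bnd[OF y] assms(3) by simp
  next
    case True
    interpret prime_set T by unfold_locales (use assms in \<open>auto simp: T_def\<close>)
    have S: "insert 2 T = S" using True by (auto simp: T_def)
    show ?thesis
    proof (cases "T = {}")
      case True
      \<comment> \<open>The recursion becomes \<open>\<Phi>\<^sub>2(x) * (x - 1) = x ^ 2 - 1\<close>
        at x = y + 1.\<close>
      have T: "cyclotomic T (y + 1) = y" "cyclotomic T ((y + 1)\<^sup>2) = (y + 2) * y"
        by (simp_all add: True cyclotomic_def proper_lcm_def power2_eq_square algebra_simps)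
      have "2 \<notin> T" by (simp add: T_def)
      then have "cyclotomic S (y + 1) * y = (y + 2) * y"
        using cyclotomic_insert[of 2 "y + 1"] y unfolding S T by simp
      then have "cyclotomic S (y + 1) = y + 2" using y by (metis mult_right_cancel not_one_le_zero)
      then show ?thesis using bnd[OF y] T by simp
    next
      case False
      \<comment> \<open>This z splits z^m exactly into y^m (y + 2)^m, so the strict lower bound for
        \<open>T\<close> at z and the upper bound at y suffice.\<close>
      define z where "z = y * (y + 2)"
      have z1: "(y + 1)\<^sup>2 = z + 1" by (simp add: z_def power2_eq_square)
      have "y ^ m * (y + 2) ^ m = z ^ m" by (simp only: z_def power_mult_distrib)
      also have "\<dots> < cyclotomic T (z + 1)" using bnd[of z] False y by (simp add: z_def)
      also have "\<dots> = cyclotomic S (y + 1) * cyclotomic T (y + 1)"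
        using cyclotomic_insert[of 2 "y + 1"] y z1 unfolding S by (simp add: T_def)
      also have "\<dots> \<le> cyclotomic S (y + 1) * (y + 2) ^ m"
        using bnd[OF y] by (intro mult_left_mono) auto
      finally show ?thesis by (rule mult_right_less_imp_less) simp
    qed
  qed
  ultimately show ?thesis by linarith
qed

text \<open>F is the n-th cyclotomic polynomial at q, obtained as \<open>cyclotomic S x\<close> for
  the set S of prime divisors of n and x = q^e, where n is e times \<open>\<Prod>S\<close>. Its
  cofactor in q^n - 1 is the lcm of the numbers q^(n/s) - 1, and a proper divisor d of n divides
  some n/s.\<close>

lemma cyclotomic_divisor:
  fixes q n :: nat
  assumes q: "q \<ge> 2" and n: "n \<ge> 2"
  obtains F where "F > q - 1" "F dvd q ^ n - 1"
    "\<And>d. d dvd n \<Longrightarrow> d \<noteq> n \<Longrightarrow> F * (q ^ d - 1) dvd q ^ n - 1"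
proof -
  define S where "S = prime_factors n"
  have n0: "n > 0" using n by simp
  interpret prime_set S by unfold_locales (auto simp: S_def)
  have "\<Prod>S dvd (\<Prod>p\<in>S. p ^ multiplicity p n)"
    by (intro prod_dvd_prod dvd_power)
       (auto simp: S_def prime_factors_multiplicity)
  also have "\<dots> = n"
    unfolding S_def using prime_factorization_nat[OF n0] by simp
  finally have "\<Prod>S dvd n" .
  then obtain e where e: "n = \<Prod>S * e" by auto
  have e0: "e > 0" using e n0 by (cases e) auto
  define x where "x = q ^ e"
  have xS: "x ^ \<Prod>S = q ^ n" by (simp add: x_def e power_mult[symmetric] mult.commute)
  have xd: "x ^ (\<Prod>S div s) = q ^ (n div s)" if "s \<in> S" for s
    using dvd[OF that] by (simp add: x_def e power_mult[symmetric] mult.commute div_mult_swap)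
  have qx: "q \<le> x" using e0 q by (simp add: x_def self_le_power)
  have "S \<noteq> {}" using n by (simp add: S_def prime_factorization_empty_iff)
  then have "x - 1 < cyclotomic S x"
    using cyclotomic_gt[of S "x - 1"] fin prime qx q by simp
  show thesis
  proof (rule that)
    show "q - 1 < cyclotomic S x" using \<open>x - 1 < _\<close> qx by linarith
    show "cyclotomic S x dvd q ^ n - 1"
      using cyclotomic_mult[of x] xS by (metis dvd_triv_left)
    fix d assume d: "d dvd n" "d \<noteq> n"
    then obtain k where k: "n = d * k" by auto
    with d have "k \<noteq> 1" by auto
    then obtain s where s: "Factorial_Ring.prime s" "s dvd k" using prime_factor_nat by blast
    have "s \<in> S" using s k n0 by (auto simp: S_def in_prime_factors_iff)
    have "d dvd n div s" using s k by auto
    then have "q ^ d - 1 dvd q ^ (n div s) - 1" by (rule power_minus_1_dvd)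
    also have "\<dots> dvd proper_lcm S x"
      unfolding proper_lcm_def using \<open>s \<in> S\<close> xd by (intro dvd_Lcm) force
    finally show "cyclotomic S x * (q ^ d - 1) dvd q ^ n - 1"
      using cyclotomic_mult[of x] xS by (metis dvd_refl mult_dvd_mono)
  qed
qed

text \<open>The gcd formula gives q^gcd(d, n) = q^d, and powers of q are injective in the
  exponent.\<close>

lemma power_minus_1_dvdD:
  fixes q :: nat
  assumes "q \<ge> 2" "q ^ d - 1 dvd q ^ n - 1"
  shows "d dvd n"
proof -
  have "q ^ gcd d n - 1 = q ^ d - 1"
    using gcd_power_minus_1[of q d n] assms by (simp add: gcd_nat.absorb1)
  moreover have "q ^ k \<ge> 1" for k using assms by simp
  ultimately have "q ^ gcd d n = q ^ d" by (metis le_add_diff_inverse)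
  then have "gcd d n = d" using assms by (simp add: power_inject_exp)
  then show ?thesis by (metis gcd_dvd2)
qed

section \<open>Finite division rings\<close>

text \<open>Taking a set as argument covers the whole ring (\<open>{}\<close>), the centre (the
  carrier) and the centralizer of one element (a singleton).\<close>

definition centralizer :: "('a, 'b) monoid_scheme \<Rightarrow> 'a set \<Rightarrow> 'a set" where
  "centralizer G A = {x \<in> carrier G. \<forall>a\<in>A. x \<otimes>\<^bsub>G\<^esub> a = a \<otimes>\<^bsub>G\<^esub> x}"

lemma (in ring) subring_centralizer:
  assumes "A \<subseteq> carrier R"
  shows "subring (centralizer R A) R"
proof (rule subringI)
  fix x y assume "x \<in> centralizer R A" "y \<in> centralizer R A"
  then have x: "x \<in> carrier R" "\<And>a. a \<in> A \<Longrightarrow> x \<otimes> a = a \<otimes> x"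
    and y: "y \<in> carrier R" "\<And>a. a \<in> A \<Longrightarrow> y \<otimes> a = a \<otimes> y"
    by (auto simp: centralizer_def)
  have "x \<otimes> y \<otimes> a = a \<otimes> (x \<otimes> y)" if "a \<in> A" for a
  proof -
    have a: "a \<in> carrier R" using that assms by auto
    have "x \<otimes> y \<otimes> a = x \<otimes> (a \<otimes> y)" using a x(1) y that by (simp add: m_assoc)
    also have "\<dots> = (x \<otimes> a) \<otimes> y" using a x(1) y(1) by (simp add: m_assoc)
    also have "\<dots> = a \<otimes> (x \<otimes> y)" unfolding x(2)[OF that] using a x(1) y(1) by (simp add: m_assoc)
    finally show ?thesis .
  qed
  with x(1) y(1) show "x \<otimes> y \<in> centralizer R A"
    by (simp add: centralizer_def)
  show "x \<oplus> y \<in> centralizer R A"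
    using subsetD[OF assms] x(1) y(1) by (simp add: centralizer_def l_distr r_distr x(2) y(2))
next
  fix x assume "x \<in> centralizer R A"
  then show "\<ominus> x \<in> centralizer R A"
    using subsetD[OF assms] by (simp add: centralizer_def l_minus r_minus)
qed (use assms in \<open>auto simp: centralizer_def\<close>)

lemma (in monoid) inv_centralizer:
  assumes "A \<subseteq> carrier G" "x \<in> centralizer G A" "x \<in> Units G"
  shows "inv x \<in> centralizer G A"
proof -
  have "inv x \<otimes> a = a \<otimes> inv x" if a: "a \<in> A" for a
  proof -
    have c: "a \<in> carrier G" "x \<otimes> a = a \<otimes> x" "x \<in> carrier G" "inv x \<in> carrier G"
      using assms a by (auto simp: centralizer_def)
    have "inv x \<otimes> a = inv x \<otimes> (a \<otimes> (x \<otimes> inv x))"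
      using c assms by simp
    also have "\<dots> = inv x \<otimes> (x \<otimes> a) \<otimes> inv x"
      using c by (simp add: m_assoc)
    also have "\<dots> = (inv x \<otimes> x) \<otimes> a \<otimes> inv x"
      using c(1,3,4) by (simp only: m_assoc m_closed)
    also have "\<dots> = a \<otimes> inv x"
      using c assms by simp
    finally show ?thesis .
  qed
  then show ?thesis using assms by (simp add: centralizer_def)
qed

text \<open>A dimension count without bases: among the K-subspaces of V whose size is a power of
  \<open>card K\<close>, take a largest one, W. If v lies outside W, then W + Kv is a larger
  subspace of size \<open>card W * card K\<close>.\<close>

lemma (in ring) card_subspace:
  assumes K: "subring K R" "\<And>k. k \<in> K \<Longrightarrow> k \<noteq> \<zero> \<Longrightarrow> \<exists>j\<in>K. j \<otimes> k = \<one>" and "\<one> \<noteq> \<zero>"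
    and V: "additive_subgroup V R" "finite V" "\<And>k v. k \<in> K \<Longrightarrow> v \<in> V \<Longrightarrow> k \<otimes> v \<in> V"
  shows "\<exists>d. card V = card K ^ d"
proof (cases "V = {\<zero>}")
  case False
  define P where "P W \<longleftrightarrow> additive_subgroup W R \<and> W \<subseteq> V \<and> (\<forall>k\<in>K. \<forall>w\<in>W. k \<otimes> w \<in> W) \<and>
    (\<exists>d. card W = card K ^ d)" for W
  interpret V: additive_subgroup V R by fact
  note Ksub = subringE[OF K(1)]
  have Kc: "k \<in> carrier R" if "k \<in> K" for k using Ksub(1) that by auto
  have Vc: "v \<in> carrier R" if "v \<in> V" for v using V.a_subset that by auto
  have "P {\<zero>}"
    unfolding P_def
    by (auto intro!: additive_subgroupI add.triv_subgroup Kc exI[of _ 0] simp: Kc)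
  moreover have "finite (Collect P)"
    by (rule finite_subset[of _ "Pow V"]) (use V(2) in \<open>auto simp: P_def\<close>)
  ultimately have "Max (card ` Collect P) \<in> card ` Collect P"
    by (intro Max_in) auto
  then obtain W where W: "P W" "card W = Max (card ` Collect P)" by auto
  have Wmax: "card U \<le> card W" if "P U" for U
    unfolding W(2) using \<open>finite (Collect P)\<close> that by (intro Max_ge) auto
  interpret W: additive_subgroup W R using W by (simp add: P_def)
  have Wc: "w \<in> carrier R" if "w \<in> W" for w using W.a_subset that by auto
  have Wneg: "\<ominus> w \<in> W" if "w \<in> W" for w using that by (simp add: W.a_inv_closed)
  have "W = V"
  proof (rule ccontr)
    assume "W \<noteq> V"
    with W obtain v where v: "v \<in> V" "v \<notin> W" by (auto simp: P_def)
    define f where "f = (\<lambda>(w, k). w \<oplus> k \<otimes> v)"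
    define U where "U = f ` (W \<times> K)"
    have vc: "v \<in> carrier R" using v Vc by auto
    \<comment> \<open>If k and l differ, then (k - l) v = u - w lies in W, and a left inverse of k -
      l brings v itself into W.\<close>
    have kl: "k = l" if "w \<in> W" "u \<in> W" "k \<in> K" "l \<in> K" "w \<oplus> k \<otimes> v = u \<oplus> l \<otimes> v" for w u k l
    proof (rule ccontr)
      assume "k \<noteq> l"
      have c: "w \<in> carrier R" "u \<in> carrier R" "k \<in> carrier R" "l \<in> carrier R"
        using that Wc Kc by auto
      have dK: "k \<ominus> l \<in> K" using that Ksub by (simp add: a_minus_def)
      have "k \<ominus> l \<noteq> \<zero>" using \<open>k \<noteq> l\<close> c by simp
      with dK K(2) obtain j where j: "j \<in> K" "j \<otimes> (k \<ominus> l) = \<one>" by blast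
      have "(k \<ominus> l) \<otimes> v = (w \<oplus> k \<otimes> v) \<ominus> w \<ominus> l \<otimes> v"
        using c vc by (simp add: a_minus_def l_distr l_minus) algebra
      also have "\<dots> = u \<ominus> w"
        unfolding that(5) using c vc by (simp add: a_minus_def) algebra
      also have "\<dots> \<in> W" using that Wneg by (simp add: a_minus_def)
      finally have "j \<otimes> ((k \<ominus> l) \<otimes> v) \<in> W" using j W by (auto simp: P_def)
      then have "v \<in> W" using j c vc Kc by (simp add: m_assoc[symmetric])
      with v show False by simp
    qed
    have "inj_on f (W \<times> K)"
    proof (rule inj_onI, clarify)
      fix w k u l assume m: "w \<in> W" "k \<in> K" "u \<in> W" "l \<in> K" and "f (w, k) = f (u, l)"
      then have e: "w \<oplus> k \<otimes> v = u \<oplus> l \<otimes> v" by (simp add: f_def)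
      have "k = l" using kl[OF m(1,3,2,4) e] .
      with e show "w = u \<and> k = l" using m Wc Kc vc by simp
    qed
    then have card: "card U = card W * card K"
      by (simp add: U_def card_image card_cartesian_product)
    have "P U"
      unfolding P_def
    proof (intro conjI ballI)
      show "additive_subgroup U R"
      proof (intro additive_subgroupI add.subgroupI)
        show "U \<subseteq> carrier R" using Wc Kc vc by (auto simp: U_def f_def)
        show "U \<noteq> {}" using W.zero_closed Ksub(2) unfolding U_def by blast
        fix a b assume "a \<in> U" "b \<in> U"
        then obtain w k u l where a: "w \<in> W" "k \<in> K" "a = w \<oplus> k \<otimes> v" and b: "u \<in> W" "l \<in> K" "b = u \<oplus> l \<otimes> v"
          by (auto simp: U_def f_def)
        have "\<ominus> a = f (\<ominus> w, \<ominus> k)" using a Wc Kc vc by (simp add: f_def minus_add l_minus)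
        then show "\<ominus> a \<in> U" using a Wneg Ksub by (auto simp: U_def)
        have "a \<oplus> b = f (w \<oplus> u, k \<oplus> l)" using a b Wc Kc vc by (simp add: f_def l_distr a_ac)
        then show "a \<oplus> b \<in> U" using a b Ksub by (auto simp: U_def)
      qed
      show "U \<subseteq> V" using W V v by (auto simp: U_def f_def P_def)
      obtain d where "card W = card K ^ d" using W by (auto simp: P_def)
      then have "card U = card K ^ Suc d" using card by simp
      then show "\<exists>d. card U = card K ^ d" ..
      fix l a assume "l \<in> K" "a \<in> U"
      then obtain w k where a: "w \<in> W" "k \<in> K" "a = w \<oplus> k \<otimes> v"
        by (auto simp: U_def f_def)
      have "l \<otimes> a = f (l \<otimes> w, l \<otimes> k)"
        using a \<open>l \<in> K\<close> Wc Kc vc by (simp add: f_def r_distr m_assoc)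
      then show "l \<otimes> a \<in> U" using a \<open>l \<in> K\<close> Ksub W by (auto simp: U_def P_def)
    qed
    then have "card W * card K \<le> card W" using Wmax card by metis
    moreover have "W \<subseteq> V" using W by (simp add: P_def)
    then have "finite W" using V(2) by (rule finite_subset)
    then have "card W > 0" using W.zero_closed card_gt_0_iff by blast
    ultimately have "card K \<le> 1" by simp
    \<comment> \<open>Needed because an infinite set has \<open>card\<close> 0, which would also
      satisfy the bound just derived.\<close>
    moreover have "finite K"
    proof -
      have "finite (f ` (W \<times> K))"
        using \<open>P U\<close> V(2) by (auto simp: U_def P_def dest: finite_subset)
      then have "finite (W \<times> K)" using \<open>inj_on f (W \<times> K)\<close> by (rule finite_imageD)
      then show ?thesis using W.zero_closed finite_cartesian_productD2 by blast
    qed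
    ultimately show False
      using Ksub(2,3) \<open>\<one> \<noteq> \<zero>\<close> by (auto simp: card_le_Suc0_iff_eq)
  qed
  then show ?thesis using W by (simp add: P_def)
qed (auto intro: exI[of _ 0])

section \<open>Wedderburn's little theorem\<close>

locale division_ring = ring +
  assumes one_not_zero: "\<one> \<noteq> \<zero>" and Units_eq: "Units R = carrier R - {\<zero>}"

text \<open>Every centralizer is a vector space over the centre, where nonzero elements have central
  inverses.\<close>

lemma (in division_ring) card_centralizer:
  assumes fin: "finite (carrier R)" and "A \<subseteq> carrier R"
  shows "\<exists>d. card (centralizer R A) = card (centralizer R (carrier R)) ^ d"
proof (rule card_subspace)
  let ?K = "centralizer R (carrier R)"
  show "subring ?K R" using subring_centralizer by blast
  fix k assume "k \<in> ?K" "k \<noteq> \<zero>"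
  then show "\<exists>j\<in>?K. j \<otimes> k = \<one>"
    using inv_centralizer[of "carrier R" k] by (intro bexI[of _ "inv k"]) (auto simp: Units_eq centralizer_def)
next
  have sub: "subring (centralizer R A) R" using subring_centralizer assms by blast
  then show "additive_subgroup (centralizer R A) R"
    by (intro additive_subgroupI subring.axioms)
  show "finite (centralizer R A)"
    by (rule finite_subset[OF _ fin]) (auto simp: centralizer_def)
  fix k v assume k: "k \<in> centralizer R (carrier R)" and v: "v \<in> centralizer R A"
  have "k \<in> centralizer R A" using k assms by (auto simp: centralizer_def)
  then show "k \<otimes> v \<in> centralizer R A" using subringE(6)[OF sub] v by blast
qed (rule one_not_zero)

text \<open>Let q be the size of the centre and q^n that of the ring. If n > 1, a noncentral
  conjugacy class has (q^n - 1) / (q^d - 1) elements for a proper divisor d of n, so the cyclotomic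
  value F divides its size. F also divides q^n - 1, hence by the class equation q - 1, although F >
  q - 1.\<close>

theorem (in division_ring) wedderburn_little:
  assumes fin: "finite (carrier R)"
  shows "field R"
proof -
  define Z where "Z = centralizer R (carrier R)"
  define G where "G = units_of R"
  define \<phi> where "\<phi> g = (\<lambda>h\<in>carrier G. g \<otimes>\<^bsub>G\<^esub> h \<otimes>\<^bsub>G\<^esub> inv\<^bsub>G\<^esub> g)" for g
  interpret G: group G unfolding G_def by (rule units_group)
  interpret act: group_action G "carrier G" \<phi>
    unfolding \<phi>_def using G.action_by_conjugation by simp
  have cG: "carrier G = carrier R - {\<zero>}" by (simp add: G_def units_of_carrier Units_eq)
  have multG: "x \<otimes>\<^bsub>G\<^esub> y = x \<otimes> y" for x y by (simp add: G_def units_of_mult)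
  have fG: "finite (carrier G)" using fin cG by simp
  have Zsub: "subring Z R" unfolding Z_def using subring_centralizer by blast
  note ZE = subringE[OF Zsub]
  have fZ: "finite Z" using fin ZE(1) by (rule rev_finite_subset)
  define q where "q = card Z"
  have "card {\<zero>, \<one>} \<le> q" unfolding q_def using ZE fZ by (intro card_mono) auto
  then have q2: "q \<ge> 2" using one_not_zero by simp
  have "centralizer R {} = carrier R" by (simp add: centralizer_def)
  then obtain n where n: "card (carrier R) = q ^ n"
    using card_centralizer[OF fin, of "{}"] by (auto simp: q_def Z_def)
  have order: "order G = q ^ n - 1"
    using fin by (simp add: order_def cG n)
  have "Z = carrier R"
  proof (rule ccontr)
    assume ne: "Z \<noteq> carrier R"
    then have "q ^ 1 < q ^ n"
      using psubset_card_mono[OF fin, of Z] ZE(1) n by (auto simp: q_def)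
    then have "n \<ge> 2" using q2 by (simp only: power_strict_increasing_iff)
    with q2 obtain F where F: "F > q - 1" "F dvd q ^ n - 1"
      "\<And>d. d dvd n \<Longrightarrow> d \<noteq> n \<Longrightarrow> F * (q ^ d - 1) dvd q ^ n - 1"
      using cyclotomic_divisor by blast
    \<comment> \<open>Conjugation by g fixes a exactly when g commutes with a; zero is removed
      because g ranges over units.\<close>
    have stab: "stabilizer G \<phi> a = centralizer R {a} - {\<zero>}" if a: "a \<in> carrier G" for a
    proof -
      have "g \<otimes>\<^bsub>G\<^esub> a \<otimes>\<^bsub>G\<^esub> inv\<^bsub>G\<^esub> g = a \<longleftrightarrow> g \<otimes> a = a \<otimes> g" if "g \<in> carrier G" for g
        using G.inv_solve_right'[OF a G.m_closed[OF that a] that] by (simp only: multG)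
      then show ?thesis
        using a by (auto simp: stabilizer_def \<phi>_def centralizer_def cG)
    qed
    have dvd_orbit: "F dvd card (orbit G \<phi> a)" if a: "a \<in> carrier G" "a \<notin> Z" for a
    proof -
      have aR: "a \<in> carrier R" using a cG by simp
      obtain d where d: "card (centralizer R {a}) = q ^ d"
        using card_centralizer[OF fin, of "{a}"] aR by (auto simp: q_def Z_def)
      have "\<zero> \<in> centralizer R {a}" using aR by (auto simp: centralizer_def)
      then have cs: "card (stabilizer G \<phi> a) = q ^ d - 1"
        using d stab[OF a(1)] by simp
      have os: "card (orbit G \<phi> a) * (q ^ d - 1) = q ^ n - 1"
        using act.orbit_stabilizer_theorem[OF a(1)] cs order by simp
      have "centralizer R {a} \<noteq> carrier R"
      proof
        assume eq: "centralizer R {a} = carrier R"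
        have "a \<otimes> x = x \<otimes> a" if "x \<in> carrier R" for x
          using that unfolding eq[symmetric] by (simp add: centralizer_def)
        then have "a \<in> Z" using aR by (simp add: Z_def centralizer_def)
        with a show False by simp
      qed
      moreover have "centralizer R {a} \<subseteq> carrier R" by (auto simp: centralizer_def)
      ultimately have "d \<noteq> n"
        using d n fin card_subset_eq by metis
      \<comment> \<open>Pure arithmetic: by the orbit-stabilizer count q^d - 1 divides q^n -
        1.\<close>
      moreover have "d dvd n"
        using power_minus_1_dvdD[OF q2] os by (metis dvd_triv_right)
      ultimately have "F * (q ^ d - 1) dvd card (orbit G \<phi> a) * (q ^ d - 1)"
        using F(3) os by simp
      moreover have "q ^ d - 1 > 0"
        using os order fG G.order_gt_0_iff_finite by (metis gr0I mult_0_right less_irrefl)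
      ultimately show ?thesis by simp
    qed
    \<comment> \<open>Central elements form singleton orbits, so the orbits of noncentral elements
      cover exactly the units outside \<open>Z\<close>.\<close>
    have central: "a = b" if ab: "a \<in> orbit G \<phi> b" "b \<in> carrier G" "b \<in> Z" for a b
    proof -
      obtain g where g: "g \<in> carrier G" "a = \<phi> g b" using ab(1) by (auto simp: orbit_def)
      have "g \<in> carrier R" using g(1) cG by simp
      then have "g \<otimes>\<^bsub>G\<^esub> b = b \<otimes>\<^bsub>G\<^esub> g"
        using that(3) by (simp add: Z_def centralizer_def multG)
      then show ?thesis
        using g that(2) by (simp add: \<phi>_def G.m_assoc)
    qed
    define N where "N = orbit G \<phi> ` (carrier G - Z)"
    have "\<Union>N = carrier G - Z"
    proof (intro subset_antisym subsetI)
      fix x assume "x \<in> \<Union>N"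
      then obtain a where a: "a \<in> carrier G" "a \<notin> Z" "x \<in> orbit G \<phi> a" by (auto simp: N_def)
      then obtain g where "g \<in> carrier G" "\<phi> g a = x" by (auto simp: orbit_def)
      then have "x \<in> carrier G" using act.element_image[of g a x] a(1) by blast
      moreover have "a \<in> orbit G \<phi> x" using a calculation act.orbit_sym by blast
      ultimately show "x \<in> carrier G - Z" using central a by blast
    qed (use act.orbit_refl in \<open>auto simp: N_def\<close>)
    moreover have "F dvd card (\<Union>N)"
    proof (rule dvd_partition)
      show "finite (\<Union>N)" using fG calculation by simp
      show "\<forall>c\<in>N. F dvd card c" using dvd_orbit by (auto simp: N_def)
      show "\<forall>c1\<in>N. \<forall>c2\<in>N. c1 \<noteq> c2 \<longrightarrow> c1 \<inter> c2 = {}"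
        using act.disjoint_union by (fastforce simp: N_def orbits_def)
    qed
    moreover have "card (carrier G - Z) = (q ^ n - 1) - (q - 1)"
    proof -
      have "carrier G - Z = carrier R - Z" using ZE(2) by (auto simp: cG)
      then have "card (carrier G - Z) = q ^ n - q"
        using n fin ZE(1) fZ by (simp add: card_Diff_subset q_def)
      then show ?thesis using q2 by simp
    qed
    moreover have "q - 1 \<le> q ^ n - 1" using \<open>q ^ 1 < q ^ n\<close> by simp
    ultimately have "F dvd q - 1" using F(2) by (metis dvd_diffD1)
    then have "F \<le> q - 1" using q2 by (intro dvd_imp_le) auto
    with F(1) show False by simp
  qed
  then have "cring R"
    by unfold_locales (auto simp: Z_def centralizer_def)
  then show ?thesis
    using Units_eq by (rule cring.cring_fieldI)
qed

section \<open>Unit graphs\<close>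

text \<open>An odd prime p dividing the order would yield some x \<noteq> 1 with x^p = 1, but x^2 =
  1 gives x^p = x.\<close>

lemma (in group) order_power_of_2:
  assumes fin: "finite (carrier G)" and inv2: "\<And>x. x \<in> carrier G \<Longrightarrow> x \<otimes> x = \<one>"
  shows "\<exists>n. order G = 2 ^ n"
proof -
  have "order G \<noteq> 0" using fin order_gt_0_iff_finite by simp
  then obtain m where m: "order G = 2 ^ multiplicity 2 (order G) * m" "\<not> 2 dvd m"
    by (rule multiplicity_decompose'[of _ "2 :: nat"]) auto
  have "m = 1"
  proof (rule ccontr)
    assume "m \<noteq> 1"
    then obtain p :: nat where p: "Factorial_Ring.prime p" "p dvd m" using prime_factor_nat by blast
    have odd: "odd p" using p m(2) by (meson dvd_trans)
    have "p dvd order G" using p m(1) by (metis dvd_mult)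
    \<comment> \<open>Cauchy's theorem, as the existence part of Sylow's theorem for exponent
      1.\<close>
    then obtain H where H: "subgroup H G" "card H = p"
      using sylow_thm[OF p(1) is_group, of 1] fin by (auto elim!: dvdE)
    interpret H: group "G\<lparr>carrier := H\<rparr>" using H(1) by (rule subgroup_imp_group)
    have "p \<ge> 2" using p(1) by (rule prime_ge_2_nat)
    then have "H \<noteq> {\<one>}" using H(2) by auto
    then obtain x where x: "x \<in> H" "x \<noteq> \<one>" using subgroup.one_closed[OF H(1)] by auto
    have xG: "x \<in> carrier G" using x(1) subgroup.subset[OF H(1)] by auto
    have "x [^] p = \<one>"
      using H.pow_order_eq_1[of x] x(1) H(2) nat_pow_consistent[of x p H] by (simp add: order_def)
    obtain k where k: "p = 2 * k + 1" using odd by (elim oddE)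
    have "x [^] (2 :: nat) = \<one>" using xG inv2 by (simp add: numeral_2_eq_2)
    then have "x [^] p = x"
      unfolding k using xG nat_pow_mult[OF xG, of "2 * k" 1] nat_pow_pow[OF xG, of 2 k] by simp
    with \<open>x [^] p = \<one>\<close> x(2) show False by simp
  qed
  with m(1) show ?thesis by auto
qed

text \<open>The graph determines its parts: two vertices share a part exactly when they are not
  adjacent. So the only candidate partition is the quotient by non-adjacency, and r is
  unique.\<close>

lemma complete_partite_iff_quotient:
  fixes G :: "'a simple_graph"
  defines "\<rho> \<equiv> {(a, b). a \<in> fst G \<and> b \<in> fst G \<and> {a, b} \<notin> snd G}"
  shows "complete_partite r G \<longleftrightarrow>
    equiv (fst G) \<rho> \<and> finite (fst G // \<rho>) \<and> card (fst G // \<rho>) = r"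
proof
  assume "complete_partite r G"
  then obtain P where P: "partition_on (fst G) P" "finite P" "card P = r"
    and same: "\<And>A a b. A \<in> P \<Longrightarrow> a \<in> A \<Longrightarrow> b \<in> A \<Longrightarrow> {a, b} \<notin> snd G"
    and diff: "\<And>A B a b. A \<in> P \<Longrightarrow> B \<in> P \<Longrightarrow> A \<noteq> B \<Longrightarrow> a \<in> A \<Longrightarrow> b \<in> B \<Longrightarrow> {a, b} \<in> snd G"
    by (auto simp: complete_partite_def)
  have "fst G = \<Union>P" using P(1) by (rule partition_onD1)
  have "\<rho> = {(x, y). \<exists>p\<in>P. x \<in> p \<and> y \<in> p}"
  proof (rule Set.set_eqI, clarify)
    fix a b
    show "(a, b) \<in> \<rho> \<longleftrightarrow> (a, b) \<in> {(x, y). \<exists>p\<in>P. x \<in> p \<and> y \<in> p}"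
    proof
      assume "(a, b) \<in> \<rho>"
      then have n: "{a, b} \<notin> snd G" and "a \<in> \<Union>P" "b \<in> \<Union>P"
        using \<open>fst G = \<Union>P\<close> by (auto simp: \<rho>_def)
      then obtain A B where A: "A \<in> P" "a \<in> A" and B: "B \<in> P" "b \<in> B" by blast
      then have "A = B" using diff[OF A(1) B(1) _ A(2) B(2)] n by blast
      with A B show "(a, b) \<in> {(x, y). \<exists>p\<in>P. x \<in> p \<and> y \<in> p}" by blast
    next
      assume "(a, b) \<in> {(x, y). \<exists>p\<in>P. x \<in> p \<and> y \<in> p}"
      then obtain A where A: "A \<in> P" "a \<in> A" "b \<in> A" by blast
      then have "a \<in> fst G" "b \<in> fst G" using \<open>fst G = \<Union>P\<close> by blast+
      then show "(a, b) \<in> \<rho>" using same[OF A] by (simp add: \<rho>_def)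
    qed
  qed
  then show "equiv (fst G) \<rho> \<and> finite (fst G // \<rho>) \<and> card (fst G // \<rho>) = r"
    using equiv_partition_on[OF P(1)] partition_on_eq_quotient[OF P(1)] P by simp
next
  assume "equiv (fst G) \<rho> \<and> finite (fst G // \<rho>) \<and> card (fst G // \<rho>) = r"
  then have eq: "equiv (fst G) \<rho>" and fin: "finite (fst G // \<rho>)" "card (fst G // \<rho>) = r" by auto
  have "{a, b} \<notin> snd G" if "A \<in> fst G // \<rho>" "a \<in> A" "b \<in> A" for A a b
    using in_quotient_imp_in_rel[OF eq that(1)] that(2,3) by (auto simp: \<rho>_def)
  moreover have "{a, b} \<in> snd G"
    if "A \<in> fst G // \<rho>" "B \<in> fst G // \<rho>" "A \<noteq> B" "a \<in> A" "b \<in> B" for A B a b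
  proof (rule ccontr)
    assume "{a, b} \<notin> snd G"
    moreover have "a \<in> fst G" "b \<in> fst G"
      using in_quotient_imp_subset[OF eq] that by blast+
    ultimately have "(a, b) \<in> \<rho>" by (simp add: \<rho>_def)
    then show False using quotient_eqI[OF eq that(1,2,4,5)] that(3) by simp
  qed
  ultimately show "complete_partite r G"
    using partition_on_quotient[OF eq] fin unfolding complete_partite_def by blast
qed

context ring
begin

text \<open>The diagonal is added because a vertex is never adjacent to itself, even if a + a is a
  unit.\<close>

definition nonadjacent :: "('a \<times> 'a) set" where
  "nonadjacent = {(a, b). a \<in> carrier R \<and> b \<in> carrier R \<and> (a = b \<or> a \<oplus> b \<notin> Units R)}"

lemma complete_partite_unit_graph_iff:
  "complete_partite r (unit_graph R) \<longleftrightarrow>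
    equiv (carrier R) nonadjacent \<and> finite (carrier R // nonadjacent) \<and> card (carrier R // nonadjacent) = r"
proof -
  have "{(a, b). a \<in> fst (unit_graph R) \<and> b \<in> fst (unit_graph R) \<and> {a, b} \<notin> snd (unit_graph R)} = nonadjacent"
    by (auto simp: unit_graph_def nonadjacent_def doubleton_eq_iff a_comm)
  then show ?thesis
    using complete_partite_iff_quotient[of r "unit_graph R"] by (simp add: unit_graph_def)
qed

section \<open>Left ideals and local rings\<close>

lemma left_idealI:
  assumes "J \<subseteq> carrier R" "\<zero> \<in> J" "\<And>a b. a \<in> J \<Longrightarrow> b \<in> J \<Longrightarrow> a \<oplus> b \<in> J"
    and "\<And>a x. a \<in> J \<Longrightarrow> x \<in> carrier R \<Longrightarrow> x \<otimes> a \<in> J"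
  shows "left_ideal J R"
proof (intro left_ideal.intro left_ideal_axioms.intro additive_subgroupI add.subgroupI ring_axioms)
  fix a assume "a \<in> J"
  then have "\<ominus> \<one> \<otimes> a \<in> J" using assms(4) by simp
  with \<open>a \<in> J\<close> show "\<ominus> a \<in> J" using assms(1) by (auto simp: l_minus subset_iff)
qed (use assms in auto)

lemma left_ideal_eq_carrier:
  assumes "left_ideal I R" "\<one> \<in> I"
  shows "I = carrier R"
proof -
  interpret I: left_ideal I R by fact
  have "x \<in> I" if "x \<in> carrier R" for x
    using I.left_closed[OF assms(2) that] that by simp
  then show ?thesis using I.a_subset by blast
qed

text \<open>Zorn's lemma; properness is phrased as not containing 1, which is preserved by unions of
  chains.\<close>

lemma ex_maximal_left_ideal:
  assumes I: "left_ideal I R" "\<one> \<notin> I"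
  shows "\<exists>M. maximal_left_ideal M R \<and> I \<subseteq> M"
proof -
  define A where "A = {J. left_ideal J R \<and> I \<subseteq> J \<and> \<one> \<notin> J}"
  have "\<exists>M\<in>A. \<forall>Y\<in>A. M \<subseteq> Y \<longrightarrow> Y = M"
  proof (rule subset_Zorn_nonempty)
    show "A \<noteq> {}" using I by (auto simp: A_def)
    fix C assume C: "C \<noteq> {}" "subset.chain A C"
    have CA: "J \<in> C \<Longrightarrow> left_ideal J R \<and> I \<subseteq> J \<and> \<one> \<notin> J" for J
      using C(2) by (auto simp: subset_chain_def A_def)
    then have sub: "J \<in> C \<Longrightarrow> additive_subgroup J R" for J by (blast dest: left_ideal.axioms)
    have "left_ideal (\<Union>C) R"
    proof (rule left_idealI)
      show "\<Union>C \<subseteq> carrier R" using sub additive_subgroup.a_subset by blast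
      show "\<zero> \<in> \<Union>C" using C(1) sub additive_subgroup.zero_closed by blast
      fix a assume "a \<in> \<Union>C"
      then obtain J where J: "J \<in> C" "a \<in> J" by auto
      show "x \<otimes> a \<in> \<Union>C" if "x \<in> carrier R" for x
        using left_ideal.left_closed[of J R a x] CA[OF J(1)] J that by blast
      fix b assume "b \<in> \<Union>C"
      then obtain K where K: "K \<in> C" "b \<in> K" by auto
      have "J \<subseteq> K \<or> K \<subseteq> J" using C(2) J K by (auto simp: subset_chain_def)
      then obtain L where L: "L \<in> C" "a \<in> L" "b \<in> L" using J K by blast
      then have "a \<oplus> b \<in> L" using additive_subgroup.a_closed[OF sub] by blast
      with L show "a \<oplus> b \<in> \<Union>C" by blast
    qed
    then show "\<Union>C \<in> A" using C(1) CA by (auto simp: A_def)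
  qed
  then obtain M where M: "M \<in> A" and max: "\<And>Y. Y \<in> A \<Longrightarrow> M \<subseteq> Y \<Longrightarrow> Y = M" by blast
  have "maximal_left_ideal M R"
  proof (intro maximal_left_ideal.intro maximal_left_ideal_axioms.intro)
    show "left_ideal M R" using M by (simp add: A_def)
    show "carrier R \<noteq> M" using M by (auto simp: A_def)
    fix J assume J: "left_ideal J R" "M \<subseteq> J"
    show "J = M \<or> J = carrier R"
    proof (cases "\<one> \<in> J")
      case True
      then show ?thesis using J left_ideal_eq_carrier by blast
    next
      case False
      then have "J \<in> A" using J M by (auto simp: A_def)
      then show ?thesis using max J by blast
    qed
  qed
  then show ?thesis using M by (auto simp: A_def)
qed

lemma left_ideal_Units_disjoint:
  assumes "left_ideal I R" "I \<noteq> carrier R"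
  shows "I \<subseteq> carrier R - Units R"
proof -
  interpret I: left_ideal I R by fact
  have "a \<notin> Units R" if "a \<in> I" for a
    using I.left_closed[OF that, of "inv a"] assms left_ideal_eq_carrier by auto
  then show ?thesis using I.a_subset by blast
qed

text \<open>An element a outside M has a left inverse y, since otherwise Ra would lie in a maximal
  left ideal, necessarily M. Making y two-sided is the work here: if a is a nonunit, then y lies in
  M, so 1 - ay lies outside M and is left invertible; but (1 - ay) a = 0 forces a = 0.\<close>

lemma local_ring_maximal_left_ideal:
  assumes "local_ring R" "maximal_left_ideal M R"
  shows "M = carrier R - Units R"
proof
  interpret M: maximal_left_ideal M R by fact
  have sub: "M \<subseteq> carrier R" by (rule M.a_subset)
  show "M \<subseteq> carrier R - Units R"
    using left_ideal_Units_disjoint M.left_ideal_axioms M.I_notcarrier by blast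
  have left_inverse: "\<exists>y\<in>carrier R. y \<otimes> a = \<one>" if a: "a \<in> carrier R" "a \<notin> M" for a
  proof (rule ccontr)
    assume no: "\<not> ?thesis"
    define I where "I = (\<lambda>x. x \<otimes> a) ` carrier R"
    have "left_ideal I R"
    proof (rule left_idealI)
      show "I \<subseteq> carrier R" using a by (auto simp: I_def)
      show "\<zero> \<in> I" using a by (auto simp: I_def intro!: image_eqI[of _ _ \<zero>])
      fix u assume "u \<in> I"
      then obtain x where x: "x \<in> carrier R" "u = x \<otimes> a" by (auto simp: I_def)
      show "z \<otimes> u \<in> I" if "z \<in> carrier R" for z
        using x a that by (auto simp: I_def m_assoc intro!: image_eqI[of _ _ "z \<otimes> x"])
      fix v assume "v \<in> I"
      then obtain y where y: "y \<in> carrier R" "v = y \<otimes> a" by (auto simp: I_def)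
      show "u \<oplus> v \<in> I"
        using x y a by (auto simp: I_def l_distr intro!: image_eqI[of _ _ "x \<oplus> y"])
    qed
    moreover have "\<one> \<notin> I" using no by (auto simp: I_def)
    ultimately obtain L where L: "maximal_left_ideal L R" "I \<subseteq> L"
      using ex_maximal_left_ideal by blast
    have "L = M" using assms L by (auto simp: local_ring_def)
    moreover have "a \<in> I" using a by (auto simp: I_def intro!: image_eqI[of _ _ \<one>])
    ultimately show False using L a by blast
  qed
  show "carrier R - Units R \<subseteq> M"
  proof (rule subsetI, rule ccontr)
    fix a assume a: "a \<in> carrier R - Units R" "a \<notin> M"
    then have aR: "a \<in> carrier R" by simp
    obtain y where y: "y \<in> carrier R" "y \<otimes> a = \<one>" using left_inverse a by blast
    have "y \<in> M"
    proof (rule ccontr)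
      assume "y \<notin> M"
      then obtain z where z: "z \<in> carrier R" "z \<otimes> y = \<one>" using left_inverse y by blast
      \<comment> \<open>A left inverse z and a right inverse a of y coincide.\<close>
      then have "z = a" using inv_unique[OF z(2) y(2) y(1) z(1) aR] by simp
      then have "a \<in> Units R" using aR y z by (auto simp: Units_def)
      with a show False by simp
    qed
    then have ay: "a \<otimes> y \<in> M" using M.left_closed aR by blast
    have "\<one> \<ominus> a \<otimes> y \<notin> M"
    proof
      assume "\<one> \<ominus> a \<otimes> y \<in> M"
      then have "(\<one> \<ominus> a \<otimes> y) \<oplus> a \<otimes> y \<in> M" using ay by (rule M.a_closed)
      moreover have "(\<one> \<ominus> a \<otimes> y) \<oplus> a \<otimes> y = \<one>" using aR y(1) by (simp add: a_minus_def a_assoc l_neg)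
      ultimately show False
        using left_ideal_eq_carrier M.left_ideal_axioms M.I_notcarrier by metis
    qed
    then obtain u where u: "u \<in> carrier R" "u \<otimes> (\<one> \<ominus> a \<otimes> y) = \<one>"
      using left_inverse[of "\<one> \<ominus> a \<otimes> y"] aR y(1) by auto
    have "(\<one> \<ominus> a \<otimes> y) \<otimes> a = a \<ominus> a \<otimes> (y \<otimes> a)"
      using aR y(1) by (simp add: a_minus_def l_distr l_minus m_assoc)
    also have "\<dots> = \<zero>" using aR y(2) by (simp add: a_minus_def r_neg)
    finally have "u \<otimes> (\<one> \<ominus> a \<otimes> y) \<otimes> a = \<zero>"
      using u(1) aR y(1) by (simp add: m_assoc)
    then have "a = \<zero>" using u(2) aR by simp
    with a(2) M.zero_closed show False by simp
  qed
qed

text \<open>Let y be a left inverse of a. Then e = ay is idempotent and e + (1 - e) = 1, so e or 1 -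
  e is a unit. As (1 - e) a = 0 with a \<noteq> 0, it is e, and a unit idempotent is 1.\<close>

lemma right_factor_of_unit:
  assumes add: "\<And>a b. a \<in> carrier R - Units R \<Longrightarrow> b \<in> carrier R - Units R \<Longrightarrow> a \<oplus> b \<notin> Units R"
    and a: "a \<in> carrier R" "x \<in> carrier R" "x \<otimes> a \<in> Units R" and "\<one> \<noteq> \<zero>"
  shows "a \<in> Units R"
proof -
  define y where "y = inv (x \<otimes> a) \<otimes> x"
  have y: "y \<in> carrier R" "y \<otimes> a = \<one>"
    using a by (simp_all add: y_def m_assoc)
  define e where "e = a \<otimes> y"
  have e: "e \<in> carrier R" using a y by (simp add: e_def)
  have ea: "e \<otimes> a = a" using a y by (simp add: e_def m_assoc)
  have "e \<in> Units R \<or> \<one> \<ominus> e \<in> Units R"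
  proof (rule ccontr)
    assume "\<not> ?thesis"
    then have "e \<oplus> (\<one> \<ominus> e) \<notin> Units R" using add e by simp
    moreover have "e \<oplus> (\<one> \<ominus> e) = \<one>" using e by (simp add: a_minus_def a_lcomm[of e] r_neg)
    ultimately show False by simp
  qed
  moreover have "\<one> \<ominus> e \<notin> Units R"
  proof
    assume u: "\<one> \<ominus> e \<in> Units R"
    have "(\<one> \<ominus> e) \<otimes> a = \<zero>"
      using e a ea by (simp add: a_minus_def l_distr l_minus r_neg)
    then have "(\<one> \<ominus> e) \<otimes> a = (\<one> \<ominus> e) \<otimes> \<zero>" using e by simp
    then have "a = \<zero>" using u a(1) by simp
    then show False using y \<open>\<one> \<noteq> \<zero>\<close> by simp
  qed
  ultimately have eU: "e \<in> Units R" by blast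
  have "e \<otimes> e = e \<otimes> \<one>" using ea a(1) y(1) e by (simp add: e_def m_assoc[symmetric])
  then have "e = \<one>" using eU e Units_l_cancel[OF eU e one_closed] by blast
  then show ?thesis using a y by (auto simp: Units_def e_def)
qed

text \<open>Proper left ideals contain no units, so once the nonunits form a left ideal, it contains
  all the others.\<close>

lemma nonunits_local_ring:
  assumes one: "\<one> \<noteq> \<zero>"
    and add: "\<And>a b. a \<in> carrier R - Units R \<Longrightarrow> b \<in> carrier R - Units R \<Longrightarrow> a \<oplus> b \<notin> Units R"
  shows "maximal_left_ideal (carrier R - Units R) R" "local_ring R"
proof -
  let ?N = "carrier R - Units R"
  have "\<zero> \<notin> Units R" using one by (auto simp: Units_def)
  have lN: "left_ideal ?N R"
  proof (rule left_idealI)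
    fix a x assume "a \<in> ?N" "x \<in> carrier R"
    then show "x \<otimes> a \<in> ?N"
      using right_factor_of_unit[OF add _ _ _ one, of a x] by blast
  qed (use \<open>\<zero> \<notin> Units R\<close> add in \<open>blast+\<close>)
  show mN: "maximal_left_ideal ?N R"
  proof (intro maximal_left_ideal.intro maximal_left_ideal_axioms.intro lN)
    show "carrier R \<noteq> ?N" by blast
    fix J assume "left_ideal J R" "?N \<subseteq> J"
    then show "J = ?N \<or> J = carrier R" using left_ideal_Units_disjoint by blast
  qed
  have "I = ?N" if "maximal_left_ideal I R" for I
  proof -
    interpret I: maximal_left_ideal I R by fact
    have "I \<subseteq> ?N" using left_ideal_Units_disjoint I.left_ideal_axioms I.I_notcarrier by blast
    then show ?thesis using I.I_maximal[OF lN] by blast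
  qed
  then show "local_ring R" unfolding local_ring_def using ring_axioms mN by blast
qed

section \<open>Non-adjacency and the cosets of the maximal left ideal\<close>

text \<open>The sums a + b and -a + b differ by a + a, a left multiple of 2 and thus in M. Hence
  non-adjacency is congruence modulo M; the diagonal fits in for the same reason.\<close>

lemma nonadjacent_eq_racong:
  assumes "left_ideal M R" "M = carrier R - Units R" "\<one> \<oplus> \<one> \<in> M"
  shows "equiv (carrier R) nonadjacent" "carrier R // nonadjacent = a_rcosets M"
proof -
  interpret M: left_ideal M R by fact
  interpret M: abelian_subgroup M R
    by (intro abelian_subgroupI3 M.additive_subgroup_axioms abelian_group_axioms)
  have dbl: "a \<oplus> a \<in> M" if "a \<in> carrier R" for a
    using M.left_closed[OF assms(3) that] that by (simp add: r_distr)
  have iff: "a = b \<or> a \<oplus> b \<notin> Units R \<longleftrightarrow> \<ominus> a \<oplus> b \<in> M" if "a \<in> carrier R" "b \<in> carrier R" for a b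
  proof -
    have "a \<oplus> b \<in> M \<longleftrightarrow> \<ominus> a \<oplus> b \<in> M"
    proof
      assume "a \<oplus> b \<in> M"
      then have "\<ominus> (a \<oplus> a) \<oplus> (a \<oplus> b) \<in> M"
        by (rule M.a_closed[OF M.a_inv_closed[OF dbl[OF that(1)]]])
      also have "\<ominus> (a \<oplus> a) \<oplus> (a \<oplus> b) = \<ominus> a \<oplus> b" using that by (simp add: minus_add a_assoc r_neg1)
      finally show "\<ominus> a \<oplus> b \<in> M" .
    next
      assume "\<ominus> a \<oplus> b \<in> M"
      then have "(a \<oplus> a) \<oplus> (\<ominus> a \<oplus> b) \<in> M"
        by (rule M.a_closed[OF dbl[OF that(1)]])
      also have "(a \<oplus> a) \<oplus> (\<ominus> a \<oplus> b) = a \<oplus> b" using that by (simp add: a_assoc r_neg2)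
      finally show "a \<oplus> b \<in> M" .
    qed
    moreover have "a \<oplus> b \<in> M" if "a = b" using dbl that \<open>a \<in> carrier R\<close> by simp
    ultimately show ?thesis using assms(2) that by blast
  qed
  then have eq: "nonadjacent = racong M"
    by (auto simp: nonadjacent_def a_r_congruent_def r_congruent_def a_inv_def)
  show "equiv (carrier R) nonadjacent" unfolding eq by (rule M.a_equiv_rcong)
  have "nonadjacent `` {a} = M +> a" if "a \<in> carrier R" for a
    using M.a_l_coset_eq_rcong[OF that] M.a_coset_eq that unfolding eq by metis
  then show "carrier R // nonadjacent = a_rcosets M"
    by (simp add: quotient_def A_RCOSETS_def')
qed

text \<open>If 2 were a unit, so would be 2^n. But the additive group R/M has order 2^n, so 2^n
  times 1 lies in M.\<close>

lemma two_mem_of_even_index: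
  assumes "left_ideal M R" "M = carrier R - Units R" "card (a_rcosets M) = 2 ^ n"
  shows "\<one> \<oplus> \<one> \<in> M"
proof (rule ccontr)
  assume "\<one> \<oplus> \<one> \<notin> M"
  then have U: "\<one> \<oplus> \<one> \<in> Units R" using assms(2) by simp
  interpret M: left_ideal M R by fact
  interpret M: abelian_subgroup M R
    by (intro abelian_subgroupI3 M.additive_subgroup_axioms abelian_group_axioms)
  interpret Q: group "R A_Mod M" by (rule M.a_factorgroup_is_group)
  interpret h: group_hom "add_monoid R" "R A_Mod M" "\<lambda>a. M +> a"
    by (intro group_hom.intro group_hom_axioms.intro M.a_r_coset_hom_A_Mod Q.is_group add.is_group)
  have "add_pow R ((2 :: nat) ^ k) \<one> \<in> Units R" for k
  proof (induction k)
    case (Suc k)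
    have "add_pow R ((2 :: nat) ^ Suc k) \<one> = add_pow R ((2 :: nat) ^ k) \<one> \<otimes> (\<one> \<oplus> \<one>)"
      using add.nat_pow_mult[of \<one> "2 ^ k" "2 ^ k"] by (simp add: r_distr mult_2)
    then show ?case using Suc U by simp
  qed simp
  moreover have "M +> add_pow R ((2 :: nat) ^ n) \<one> = M"
    using h.hom_nat_pow[of \<one> "2 ^ n"] Q.pow_order_eq_1[of "M +> \<one>"] assms(3)
    by (simp add: A_FactGroup_def' order_def add_pow_def a_rcosetsI M.a_subset)
  then have "add_pow R ((2 :: nat) ^ n) \<one> \<in> M"
    using M.a_rcos_self[of "add_pow R ((2 :: nat) ^ n) \<one>"] by simp
  ultimately show False using assms(2) by blast
qed

text \<open>As 2 lies in M, every coset is its own negative; n > 0 because M is proper.\<close>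

lemma card_a_rcosets_power_of_2:
  assumes "left_ideal M R" "\<one> \<oplus> \<one> \<in> M" "M \<noteq> carrier R" "finite (a_rcosets M)"
  shows "\<exists>n>0. card (a_rcosets M) = 2 ^ n"
proof -
  interpret M: left_ideal M R by fact
  interpret M: abelian_subgroup M R
    by (intro abelian_subgroupI3 M.additive_subgroup_axioms abelian_group_axioms)
  interpret Q: group "R A_Mod M" by (rule M.a_factorgroup_is_group)
  have c: "carrier (R A_Mod M) = a_rcosets M" by (simp add: A_FactGroup_def')
  have "Y \<otimes>\<^bsub>R A_Mod M\<^esub> Y = \<one>\<^bsub>R A_Mod M\<^esub>" if Y: "Y \<in> carrier (R A_Mod M)" for Y
  proof -
    obtain a where a: "a \<in> carrier R" "Y = M +> a" using Y c by (auto simp: A_RCOSETS_def')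
    have "a \<oplus> a \<in> M" using M.left_closed[OF assms(2) a(1)] a(1) by (simp add: r_distr)
    then show ?thesis
      using a M.a_rcos_sum by (simp add: A_FactGroup_def' M.a_rcos_const)
  qed
  then obtain n where n: "card (a_rcosets M) = 2 ^ n"
    using Q.order_power_of_2 assms(4) c by (auto simp: order_def)
  have "n \<noteq> 0"
  proof
    assume "n = 0"
    then have "a_rcosets M = {M}" using n M.a_subgroup_in_rcosets by (auto simp: card_1_singleton_iff)
    then show False using M.a_rcosets_part_G assms(3) by simp
  qed
  then show ?thesis using n by blast
qed

lemma unit_graph_complete_partite_cases:
  assumes one: "\<one> \<noteq> \<zero>" and eq: "equiv (carrier R) nonadjacent" and fin: "finite (carrier R // nonadjacent)"
  shows "(local_ring R \<and> (\<exists>M n. maximal_left_ideal M R \<and> n > 0 \<and> card (a_rcosets M) = 2 ^ n)) \<or>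
    (field R \<and> finite (carrier R))"
proof -
  let ?N = "carrier R - Units R"
  have zU: "\<zero> \<notin> Units R" using one by (auto simp: Units_def)
  have trans: "(a, c) \<in> nonadjacent" if "(a, b) \<in> nonadjacent" "(b, c) \<in> nonadjacent" for a b c
    using eq that by (meson equivE transE)
  have sym: "(b, a) \<in> nonadjacent" if "(a, b) \<in> nonadjacent" for a b
    using eq that by (meson equivE symE)
  have add: "a \<oplus> b \<notin> Units R" if "a \<in> ?N" "b \<in> ?N" for a b
  proof (cases "a = b")
    \<comment> \<open>The graph has no loops and says nothing about a + a. But a + a is the product
      of a and 2 in either order, so if it is a unit, a has a left and a right inverse.\<close>
    case True
    show ?thesis
    proof
      assume u: "a \<oplus> b \<in> Units R"
      have aR: "a \<in> carrier R" using that by simp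
      let ?i = "inv (a \<oplus> b)" and ?t = "\<one> \<oplus> \<one>"
      have "a \<oplus> b = a \<otimes> ?t" "a \<oplus> b = ?t \<otimes> a"
        using True aR by (simp_all add: l_distr r_distr)
      moreover have i: "?i \<in> carrier R" using u by simp
      ultimately have r: "a \<otimes> (?t \<otimes> ?i) = \<one>" and l: "(?i \<otimes> ?t) \<otimes> a = \<one>"
        using u aR Units_r_inv[OF u] Units_l_inv[OF u] by (simp_all only: m_assoc a_closed one_closed)
      have "?i \<otimes> ?t = ?t \<otimes> ?i"
        using inv_unique[OF l r] aR i by simp
      then have "a \<in> Units R"
        using aR i l r unfolding Units_def by (intro CollectI conjI bexI[of _ "?t \<otimes> ?i"]) auto
      with that show False by simp
    qed
  next
    case False
    have "(a, \<zero>) \<in> nonadjacent" "(\<zero>, b) \<in> nonadjacent" using that by (auto simp: nonadjacent_def)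
    then have "(a, b) \<in> nonadjacent" by (rule trans)
    with False show ?thesis by (simp add: nonadjacent_def)
  qed
  note loc = nonunits_local_ring[OF one add]
  then have lN: "left_ideal ?N R" by (blast dest: maximal_left_ideal.axioms)
  interpret N: left_ideal ?N R by fact
  show ?thesis
  proof (cases "?N = {\<zero>}")
    case True
    then have "Units R = carrier R - {\<zero>}" using zU by blast
    then interpret division_ring R by unfold_locales (use one in auto)
    have "finite Y" if Y: "Y \<in> carrier R // nonadjacent" for Y
    proof -
      obtain a where a: "a \<in> carrier R" "Y = nonadjacent `` {a}" using Y by (auto elim: quotientE)
      have "Y \<subseteq> {a, \<ominus> a}"
      proof
        fix b assume "b \<in> Y"
        then have b: "b \<in> carrier R" "a = b \<or> a \<oplus> b \<notin> Units R"
          using a by (auto simp: nonadjacent_def)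
        moreover have "a \<oplus> b = \<zero>" if "a \<oplus> b \<notin> Units R"
          using that a_closed[OF a(1) b(1)] unfolding Units_eq by blast
        ultimately have "a = b \<or> b \<oplus> a = \<zero>"
          unfolding a_comm[OF b(1) a(1)] by blast
        then show "b \<in> {a, \<ominus> a}" using minus_equality[of b a] a(1) b(1) by blast
      qed
      then show ?thesis by (rule finite_subset) simp
    qed
    then have "finite (\<Union>(carrier R // nonadjacent))" using fin by blast
    then have "finite (carrier R)" using Union_quotient[OF eq] by simp
    then show ?thesis using wedderburn_little by blast
  next
    case False
    then obtain x where x: "x \<in> ?N" "x \<noteq> \<zero>" using N.zero_closed by blast
    have xR: "x \<in> carrier R" using x by simp
    have "\<one> \<oplus> (x \<ominus> \<one>) = x" using xR by (simp add: a_minus_def a_lcomm r_neg)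
    then have "(\<one>, x \<ominus> \<one>) \<in> nonadjacent" using x by (simp add: nonadjacent_def)
    moreover have "(\<one>, \<ominus> \<one>) \<in> nonadjacent" using zU by (simp add: nonadjacent_def r_neg)
    ultimately have "(x \<ominus> \<one>, \<ominus> \<one>) \<in> nonadjacent" using sym trans by blast
    \<comment> \<open>Distinctness excludes the diagonal of \<open>nonadjacent\<close>, so the sum x
      - 2 is a nonunit, and 2 = x - (x - 2) is one as well.\<close>
    moreover have "x \<ominus> \<one> \<noteq> \<ominus> \<one>"
      using x xR by (metis a_minus_def add.r_cancel_one' one_closed a_inv_closed add.l_cancel_one)
    ultimately have "x \<ominus> \<one> \<oplus> \<ominus> \<one> \<in> ?N" using xR by (simp add: nonadjacent_def)
    then have "x \<oplus> \<ominus> (x \<ominus> \<one> \<oplus> \<ominus> \<one>) \<in> ?N" using N.a_closed[OF x(1) N.a_inv_closed] by blast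
    also have "x \<oplus> \<ominus> (x \<ominus> \<one> \<oplus> \<ominus> \<one>) = \<one> \<oplus> \<one>"
      using xR by (simp add: a_minus_def minus_add a_assoc r_neg2)
    finally have two: "\<one> \<oplus> \<one> \<in> ?N" .
    have "finite (a_rcosets ?N)" using nonadjacent_eq_racong(2)[OF lN refl two] fin by simp
    then have "\<exists>n>0. card (a_rcosets ?N) = 2 ^ n"
      using card_a_rcosets_power_of_2[OF lN two] by blast
    then show ?thesis using loc by blast
  qed
qed

text \<open>Serves both for the existence of r and for its value, the number of cosets.\<close>

lemma local_ring_complete_partite_iff:
  assumes "local_ring R" "maximal_left_ideal M R" "card (a_rcosets M) = 2 ^ n"
  shows "complete_partite r (unit_graph R) \<longleftrightarrow> r = 2 ^ n"
proof -
  have M: "M = carrier R - Units R" using assms local_ring_maximal_left_ideal by blast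
  have lM: "left_ideal M R" using assms(2) by (blast dest: maximal_left_ideal.axioms)
  \<comment> \<open>A positive \<open>card\<close> implies finiteness, since infinite sets have
    \<open>card\<close> 0.\<close>
  have "finite (a_rcosets M)" using assms(3) by (intro card_ge_0_finite) simp
  then show ?thesis
    using nonadjacent_eq_racong[OF lM M two_mem_of_even_index[OF lM M assms(3)]] assms(3)
    by (auto simp: complete_partite_unit_graph_iff)
qed

end

text \<open>Zero is the only nonunit, so a and b are non-adjacent exactly when a = b or a =
  -b.\<close>

lemma (in field) equiv_nonadjacent: "equiv (carrier R) nonadjacent"
proof -
  have na: "nonadjacent = {(a, b). a \<in> carrier R \<and> b \<in> carrier R \<and> (a = b \<or> a = \<ominus> b)}"
    unfolding nonadjacent_def using minus_equality l_neg r_neg by (fastforce simp: field_Units)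
  show ?thesis
    unfolding na by (rule equivI) (auto simp: refl_on_def sym_def trans_def)
qed

text \<open>The residue structure enters only through its set of additive cosets, and its
  \<open>card\<close> being 2^n includes its finiteness.\<close>

theorem theorem3p1:
  fixes R (structure)
  assumes "ring R" and "\<one> \<noteq> \<zero>"
  shows "((\<exists>r>0. complete_partite r (unit_graph R)) \<longleftrightarrow>
            (local_ring R \<and>
              (\<exists>\<mm> n. maximal_left_ideal \<mm> R \<and> n > 0 \<and> card (a_rcosets \<mm>) = 2 ^ n)) \<or>
            (field R \<and> finite (carrier R))) \<and>
         (\<forall>\<mm> n r. local_ring R \<and> maximal_left_ideal \<mm> R \<and> n > 0 \<and> card (a_rcosets \<mm>) = 2 ^ n \<and>
            r > 0 \<and> complete_partite r (unit_graph R) \<longrightarrow>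
            r = card (a_rcosets \<mm>) \<and> r = 2 ^ n)"
    (is "(?partite \<longleftrightarrow> ?local \<or> ?field) \<and> ?index")
proof -
  interpret ring R by fact
  have "?local \<or> ?field" if ?partite
    using that unit_graph_complete_partite_cases[OF assms(2)]
    unfolding complete_partite_unit_graph_iff by blast
  moreover have ?partite if l: ?local
  proof -
    obtain M n where "local_ring R" "maximal_left_ideal M R" "card (a_rcosets M) = 2 ^ n"
      using l by blast
    then show ?thesis
      using local_ring_complete_partite_iff by (intro exI[of _ "2 ^ n"]) simp
  qed
  moreover have ?partite if f: ?field
  proof -
    interpret field R using f by blast
    have "finite (carrier R // nonadjacent)"
      using f by (simp add: quotient_def)
    \<comment> \<open>This makes the number of classes positive.\<close>
    moreover have "carrier R // nonadjacent \<noteq> {}"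
      by (auto simp: quotient_def)
    ultimately show ?thesis
      using equiv_nonadjacent by (auto simp: complete_partite_unit_graph_iff card_gt_0_iff)
  qed
  moreover have ?index
    using local_ring_complete_partite_iff by metis
  ultimately show ?thesis by blast
qed

end
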